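(* Let $f\in O_n$, let $\mathbf t$ be any direction, and let $\mu$ be a random phase mask satisfying the Mask Assumption. Then almost surely (with respect to $\mu$) the following holds. If $g\in O_n$ satisfies $$|\mathcal F(e^{\mathrm i\kappa g^*_{\mathbf t}})|^2=|\mathcal F(e^{\mathrm i\kappa f^*_{\mathbf t}})|^2\quad\text{and}\quad |\mathcal F(\mu\odot e^{\mathrm i\kappa g^*_{\mathbf t}})|^2=|\mathcal F(\mu\odot e^{\mathrm i\kappa f^*_{\mathbf t}})|^2$$ on $[-\tfrac12,\tfrac12]^2$, then $e^{\mathrm i\kappa g_{\mathbf t}}=e^{\mathrm i\kappa f_{\mathbf t}}$ on $\mathbb Z_p^2$.
   Context: Let $n$ be a positive odd integer, $p=2n-1$, and for odd $m$ let $\mathbb Z_m=\{-(m-1)/2,\dots,(m-1)/2\}$. $O_n$ is the set of all functions $f:\mathbb Z_n^3\to\mathbb C$. The wavenumber is $\kappa=\pi$. Let $D_p(t)=\frac1p\sum_{l\in\mathbb Z_p}e^{\mathrm i2\pi lt/p}$ and, for $f\in O_n$, $\widetilde f(x,y,z)=\sum_{i,j,k\in\mathbb Z_n}f(i,j,k)D_p(x-i)D_p(y-j)D_p(z-k)$ for $x,y,z\in\mathbb R$. Directions $\mathbf t$ are vectors of one of the forms $(1,\alpha,\beta)$, $(\alpha,1,\beta)$, $(\alpha,\beta,1)$ with $|\alpha|,|\beta|<1$. The discrete projection $f_{\mathbf t}:\mathbb Z_p^2\to\mathbb C$ is, for $(c_1,c_2)\in\mathbb Z_p^2$, $f_{(1,\alpha,\beta)}(c_1,c_2)=\sum_{i\in\mathbb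 Z_n}\widetilde f(i,\alpha i+c_1,\beta i+c_2)$, $f_{(\alpha,1,\beta)}(c_1,c_2)=\sum_{j\in\mathbb Z_n}\widetilde f(\alpha j+c_1,j,\beta j+c_2)$, $f_{(\alpha,\beta,1)}(c_1,c_2)=\sum_{k\in\mathbb Z_n}\widetilde f(\alpha k+c_1,\beta k+c_2,k)$. Translated projections: for the direction $\mathbf t$ there is a shift $\mathbf l_{\mathbf t}\in\mathbb Z^2$ (the same for $f$ and $g$), and $f^*_{\mathbf t}(\mathbf n)=f_{\mathbf t}(\mathbf n+\mathbf l_{\mathbf t})$, $g^*_{\mathbf t}(\mathbf n)=g_{\mathbf t}(\mathbf n+\mathbf l_{\mathbf t})$ (projections being extended by zero outside $\mathbb Z_p^2$). It is a standing assumption that $\operatorname{supp}(f^*_{\mathbf t})\subseteq\mathbb Z_n^2$ and $\operatorname{supp}(g^*_{\mathbf t})\subseteq\mathbb Z_n^2$. For $u:\mathbb Z_p^2\to\mathbb C$, $\mathcal F(u)(\mathbf w)=\sum_{\mathbf n\in\mathbb Z_p^2}u(\mathbf n)e^{-\mathrm i2\pi\mathbf n\cdot\mathbf w}$, $\mathbf w\in[-\frac12,\frac12]^2$; $\odot$ is the entrywise product, and $e^{\mathrm i\kappa f^*_{\mathbf t}}$ is taken entrywise on $\mathbb Z_p^2$. Mask Assumption: $\mu(\mathbf n)=\exp[\mathrm i\phi(\mathbf n)]$, $\mathbf n\in\mathbb Z_p^2$, where the $\phi(\mathbf n)$ are independent, continuous real-valued random variables (i.e. with continuous distribution functions).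
   Formalization: The case n = 1 is excluded, so n is odd with n > 1: for n = 1 the claim is false (f = 0, g = 1/2, zero shift satisfy all hypotheses for every mask, yet the two phase values are i and 1). *)

theory Defs
  imports "HOL-Probability.Probability"
begin

(* Used for odd m only, where (m - 1) / 2 is an integer. *)
definition centered :: "nat \<Rightarrow> int set" where
  "centered m = {- ((int m - 1) div 2) .. (int m - 1) div 2}"

definition grid2 :: "nat \<Rightarrow> (int \<times> int) set" where
  "grid2 m = centered m \<times> centered m"

definition grid3 :: "nat \<Rightarrow> (int \<times> int \<times> int) set" where
  "grid3 m = centered m \<times> centered m \<times> centered m"

definition objects :: "nat \<Rightarrow> (int \<times> int \<times> int \<Rightarrow> complex) set" where
  "objects n = grid3 n \<rightarrow>\<^sub>E UNIV"

definition kappa :: real where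
  "kappa = pi"

(* The padded size p belonging to the object size n; the subtraction is on nat, with n positive.
   For n = 1 there is no padding: p = 1, the intensity data only determine |exp (i kappa f)|, and
   uniqueness fails (f = 0, g = 1/2), which is why the theorem takes n > 1. *)
definition padded :: "nat \<Rightarrow> nat" where
  "padded n = 2 * n - 1"

definition dirichlet :: "nat \<Rightarrow> real \<Rightarrow> complex" where
  "dirichlet p t =
     (1 / of_nat p) * (\<Sum>l\<in>centered p. exp (\<i> * of_real (2 * pi * of_int l * t / of_nat p)))"

definition interpolant ::
    "nat \<Rightarrow> (int \<times> int \<times> int \<Rightarrow> complex) \<Rightarrow> real \<Rightarrow> real \<Rightarrow> real \<Rightarrow> complex" where
  "interpolant n f x y z =
     (\<Sum>(i, j, k)\<in>grid3 n. f (i, j, k) *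
        dirichlet (padded n) (x - of_int i) *
        dirichlet (padded n) (y - of_int j) *
        dirichlet (padded n) (z - of_int k))"

definition directions :: "(real \<times> real \<times> real) set" where
  "directions =
     {(1, \<alpha>, \<beta>) | \<alpha> \<beta>. \<bar>\<alpha>\<bar> < 1 \<and> \<bar>\<beta>\<bar> < 1} \<union>
     {(\<alpha>, 1, \<beta>) | \<alpha> \<beta>. \<bar>\<alpha>\<bar> < 1 \<and> \<bar>\<beta>\<bar> < 1} \<union>
     {(\<alpha>, \<beta>, 1) | \<alpha> \<beta>. \<bar>\<alpha>\<bar> < 1 \<and> \<bar>\<beta>\<bar> < 1}"

(* Exactly one coordinate of a direction equals 1, so the three forms are disjoint and the case
   distinction below identifies the form. The projection is extended by zero outside Z_p^2. *)
definition projection ::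
    "nat \<Rightarrow> (int \<times> int \<times> int \<Rightarrow> complex) \<Rightarrow> real \<times> real \<times> real \<Rightarrow> int \<times> int \<Rightarrow> complex" where
  "projection n f = (\<lambda>(t1, t2, t3) (c1, c2).
     if (c1, c2) \<notin> grid2 (padded n) then 0
     else if t1 = 1 then
       (\<Sum>i\<in>centered n. interpolant n f (of_int i) (t2 * of_int i + of_int c1) (t3 * of_int i + of_int c2))
     else if t2 = 1 then
       (\<Sum>j\<in>centered n. interpolant n f (t1 * of_int j + of_int c1) (of_int j) (t3 * of_int j + of_int c2))
     else
       (\<Sum>k\<in>centered n. interpolant n f (t1 * of_int k + of_int c1) (t2 * of_int k + of_int c2) (of_int k)))"

definition translated ::
    "nat \<Rightarrow> (int \<times> int \<times> int \<Rightarrow> complex) \<Rightarrow> real \<times> real \<times> real \<Rightarrow> int \<times> int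
       \<Rightarrow> int \<times> int \<Rightarrow> complex" where
  "translated n f t l m = projection n f t (m + l)"

(* The support is taken in all of Z^2, so that the translation does not push any nonzero value of
   the projection out of Z_p^2. *)
definition supported ::
    "nat \<Rightarrow> (int \<times> int \<times> int \<Rightarrow> complex) \<Rightarrow> real \<times> real \<times> real \<Rightarrow> int \<times> int \<Rightarrow> bool" where
  "supported n f t l \<longleftrightarrow> support_on UNIV (translated n f t l) \<subseteq> grid2 n"

definition phase_object :: "(int \<times> int \<Rightarrow> complex) \<Rightarrow> int \<times> int \<Rightarrow> complex" where
  "phase_object u m = exp (\<i> * of_real kappa * u m)"

definition fourier :: "nat \<Rightarrow> (int \<times> int \<Rightarrow> complex) \<Rightarrow> real \<times> real \<Rightarrow> complex" where
  "fourier p u = (\<lambda>(w1, w2). \<Sum>(m1, m2)\<in>grid2 p.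
     u (m1, m2) * exp (- \<i> * of_real (2 * pi * (of_int m1 * w1 + of_int m2 * w2))))"

(* A continuous random variable is one with continuous distribution function; a density is not
   required. Measurability of the phases is part of indep_vars. *)
definition mask_assumption ::
    "'w measure \<Rightarrow> nat \<Rightarrow> (int \<times> int \<Rightarrow> 'w \<Rightarrow> complex) \<Rightarrow> bool" where
  "mask_assumption M p \<mu> \<longleftrightarrow> prob_space M \<and>
     (\<exists>\<phi> :: int \<times> int \<Rightarrow> 'w \<Rightarrow> real.
        prob_space.indep_vars M (\<lambda>_. borel) \<phi> (grid2 p) \<and>
        (\<forall>m\<in>grid2 p. continuous_on UNIV (cdf (distr M borel (\<phi> m)))) \<and>
        (\<forall>m\<in>grid2 p. \<forall>\<omega>\<in>space M. \<mu> m \<omega> = exp (\<i> * of_real (\<phi> m \<omega>))))"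

end

theory Submission
  imports Defs "HOL-Computational_Algebra.Polynomial_Factorial" "HOL-Computational_Algebra.Field_as_Ring"
begin

text \<open>
  Both phase objects equal 1 on the frame of the padded grid. Kronecker's substitution turns the
  phase object of \<open>g\<close> into a monic univariate polynomial whose modulus on the unit circle is
  prescribed by the unmasked intensities. Such a polynomial divides a fixed nonzero polynomial (the
  product of that of \<open>f\<close> with its conjugate reflection), so only finitely many candidates
  remain, and they do not depend on the mask. A single candidate \<open>u\<close> different from the
  phase object \<open>v\<close> of \<open>f\<close> already violates the masked equation at frequency 0 almost surely:
  the random phase at a point where \<open>u\<close> and \<open>v\<close> differ makes the two sums over all
  points other than a corner different, and then at most two values of the mask at the corner give
  equal moduli.
\<close>

section \<open>Polynomials with prescribed modulus on the unit circle\<close>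

text \<open>By unique factorization a monic divisor is recovered from its multiset of prime factors,
  which is one of the finitely many submultisets of that of \<open>P\<close>.\<close>

lemma finite_monic_divisors:
  fixes P :: "complex poly"
  assumes "P \<noteq> 0"
  shows "finite {d. d dvd P \<and> lead_coeff d = 1}"
proof -
  have "d \<in> (\<lambda>A. normalize (prod_mset A)) ` {A. A \<subseteq># prime_factorization P}"
    if "d dvd P" "lead_coeff d = 1" for d
  proof -
    from that have "d \<noteq> 0" by auto
    moreover from that have "normalize d = d" by (simp add: poly_eq_iff)
    ultimately show ?thesis
      using that assms
      by (intro image_eqI[of _ _ "prime_factorization d"])
        (auto simp: prod_mset_prime_factorization_weak prime_factorization_subset_iff_dvd)
  qed
  moreover have "finite {A. A \<subseteq># prime_factorization P}"
  proof (rule finite_subset)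
    show "{A. A \<subseteq># B} \<subseteq> (\<Union>k\<le>size B. multisets_of_size (set_mset B) k)" for B :: "complex poly multiset"
      by (auto simp: multisets_of_size_def dest: size_mset_mono mset_subset_eqD)
  qed auto
  ultimately show ?thesis
    by (blast intro: finite_subset finite_imageI)
qed

text \<open>On the unit circle \<open>inverse (cnj z) = z\<close>, so the reflected polynomial at
  \<open>cnj z\<close> involves the value of \<open>q\<close> at \<open>z\<close> itself. This turns
  the conjugate of \<open>q\<close> into a polynomial there, up to a power of
  \<open>z\<close>.\<close>

lemma poly_conj_reflect_unit_circle:
  fixes q :: "complex poly"
  assumes "cmod z = 1"
  shows "poly (map_poly cnj (reflect_poly q)) z = z ^ degree q * cnj (poly q z)"
proof -
  have z: "z \<noteq> 0" "inverse (cnj z) = z"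
    using assms complex_norm_square[of z] by (auto intro: inverse_unique simp: mult.commute)
  have "poly (map_poly cnj (reflect_poly q)) z = cnj (poly (reflect_poly q) (cnj z))"
    by (metis complex_cnj_cnj poly_cnj)
  also have "\<dots> = z ^ degree q * cnj (poly q z)"
    by (subst poly_reflect_poly_nz) (use z in auto)
  finally show ?thesis .
qed

lemma poly_eq_on_unit_circle:
  fixes P Q :: "complex poly"
  assumes "\<And>z. cmod z = 1 \<Longrightarrow> poly P z = poly Q z"
  shows "P = Q"
proof (rule ccontr)
  assume "P \<noteq> Q"
  then have "finite {z. poly (P - Q) z = 0}"
    by (intro poly_roots_finite) simp
  moreover have "sphere 0 1 \<subseteq> {z. poly (P - Q) z = 0}"
    using assms by auto
  \<comment> \<open>A finite connected set has at most one point, but the circle contains 1 and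
    -1.\<close>
  moreover have "infinite (sphere (0::complex) 1)"
  proof
    assume "finite (sphere (0::complex) 1)"
    moreover have "connected (sphere (0::complex) 1)"
      by (intro connected_sphere) simp
    moreover have "1 \<in> sphere (0::complex) 1" "-1 \<in> sphere (0::complex) 1" by auto
    ultimately show False
      by (metis connected_finite_iff_sing empty_iff singletonD one_neq_neg_one)
  qed
  ultimately show False
    by (blast dest: finite_subset)
qed

text \<open>With \<open>R\<close> the conjugate reflection, \<open>q * R q\<close> on the circle is
  \<open>z ^ degree q\<close> times the squared modulus of \<open>q\<close>. Equal degrees and
  moduli therefore give \<open>q * R q = f * R f\<close>, first on the circle and then as
  polynomials.\<close>

lemma finite_same_modulus_unit_circle:
  fixes f :: "complex poly"
  assumes "f \<noteq> 0"
  shows "finite {q. degree q = degree f \<and> lead_coeff q = 1 \<and>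
    (\<forall>z. cmod z = 1 \<longrightarrow> cmod (poly q z) = cmod (poly f z))}"
proof -
  define R :: "complex poly \<Rightarrow> complex poly" where "R q = map_poly cnj (reflect_poly q)" for q
  have R: "poly (q * R q) z = z ^ degree q * of_real ((cmod (poly q z))\<^sup>2)" if "cmod z = 1" for q z
    unfolding R_def poly_mult poly_conj_reflect_unit_circle[OF that] complex_norm_square by simp
  have "q dvd f * R f"
    if "degree q = degree f" "\<forall>z. cmod z = 1 \<longrightarrow> cmod (poly q z) = cmod (poly f z)" for q
  proof -
    have "q * R q = f * R f"
      by (rule poly_eq_on_unit_circle) (simp only: R that)
    then show ?thesis by (metis dvd_triv_left)
  qed
  moreover have "f * R f \<noteq> 0"
    using assms by (simp add: R_def map_poly_eq_0_iff)
  ultimately show ?thesis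
    by (intro finite_subset[OF _ finite_monic_divisors[of "f * R f"]]) auto
qed

section \<open>Random phases and null events\<close>

lemma countable_cis_eq: "countable {x. cis x = c}"
proof (cases "\<exists>y. cis y = c")
  case True
  then obtain y where y: "cis y = c" by blast
  have "{x. cis x = c} \<subseteq> range (\<lambda>k::int. y + 2 * pi * of_int k)"
  proof
    fix x assume "x \<in> {x. cis x = c}"
    with y have "cis x = cis y" by simp
    then show "x \<in> range (\<lambda>k::int. y + 2 * pi * of_int k)"
      using sin_cos_eq_iff[of x y] by (auto simp: complex_eq_iff)
  qed
  then show ?thesis by (rule countable_subset) auto
qed auto

text \<open>The condition is a nontrivial quadratic equation for \<open>cis x\<close>, which leaves
  at most two values of \<open>cis x\<close>, each taken at countably many \<open>x\<close>.\<close>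

lemma countable_cis_norm_eq:
  assumes "A \<noteq> B" "c \<noteq> 0"
  shows "countable {x. cmod (cis x * c + A) = cmod (cis x * c + B)}"
proof -
  \<comment> \<open>With \<open>w = cis x\<close>, this is the difference of the two squared moduli,
    expanded and multiplied by \<open>w\<close> to clear \<open>cnj w = 1 / w\<close>. Its constant
    coefficient is nonzero.\<close>
  define P where "P = [:cnj c * (A - B), of_real ((cmod A)\<^sup>2 - (cmod B)\<^sup>2), c * cnj (A - B):]"
  have "P \<noteq> 0" using assms by (simp add: P_def)
  then have "finite {u. poly P u = 0}" by (rule poly_roots_finite)
  then have "countable (\<Union>u\<in>{u. poly P u = 0}. {x. cis x = u})"
    by (intro countable_UN countable_cis_eq) (auto intro: countable_finite)
  moreover have "poly P (cis x) = 0" if eq: "cmod (cis x * c + A) = cmod (cis x * c + B)" for x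
  proof -
    have "of_real ((cmod (cis x * c + A))\<^sup>2) = (of_real ((cmod (cis x * c + B))\<^sup>2) :: complex)"
      using eq by simp
    then have "(cis x * c + A) * cnj (cis x * c + A) - (cis x * c + B) * cnj (cis x * c + B) = 0"
      unfolding complex_norm_square by simp
    moreover have "cis x * cnj (cis x) = 1"
      by (simp add: cis_cnj cis_mult)
    moreover have "poly P (cis x) = cnj c * (A - B) + cis x * (A * cnj A - B * cnj B) + cis x * cis x * c * cnj (A - B)"
      unfolding P_def of_real_diff complex_norm_square by (simp add: algebra_simps)
    ultimately show ?thesis by (simp only: complex_cnj_add complex_cnj_mult complex_cnj_diff) algebra
  qed
  ultimately show ?thesis by (rule_tac countable_subset) auto
qed

text \<open>Where the distribution function is continuous, single points carry no mass; countable
  additivity does the rest.\<close>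

lemma AE_notin_countable_of_continuous_cdf:
  assumes "real_distribution M" "continuous_on UNIV (cdf M)" "countable S"
  shows "AE x in M. x \<notin> S"
proof -
  interpret real_distribution M by fact
  have "emeasure M {x} = 0" for x
    using assms(2) isCont_cdf[of x]
    by (simp add: continuous_on_eq_continuous_at emeasure_eq_measure)
  then have "AE y in M. y \<noteq> x" for x
    by (intro AE_I[of _ _ "{x}"]) auto
  then have "AE y in M. \<forall>x\<in>S. y \<noteq> x"
    using assms(3) by (subst AE_ball_countable) auto
  then show ?thesis by (rule AE_mp) auto
qed

text \<open>A Fubini argument: by independence the joint law of \<phi> at \<open>i\<close> and of
  the remaining phases is a product. For each fixed value \<open>y\<close> of the remaining phases
  the bad set is countable, hence null.\<close>

lemma (in prob_space) AE_indep_vars_countable_fibres: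
  fixes \<phi> :: "'i \<Rightarrow> 'a \<Rightarrow> real"
  assumes indep: "indep_vars (\<lambda>_. borel) \<phi> I" and "i \<in> I"
    and cont: "continuous_on UNIV (cdf (distr M borel (\<phi> i)))"
    and meas: "Measurable.pred (PiM (I - {i}) (\<lambda>_. borel) \<Otimes>\<^sub>M borel) (\<lambda>z. Q (fst z) (snd z))"
    and count: "\<And>y. countable {x. Q y x}"
  shows "AE \<omega> in M. \<not> Q (restrict (\<lambda>j. \<phi> j \<omega>) (I - {i})) (\<phi> i \<omega>)"
proof -
  let ?N = "PiM (I - {i}) (\<lambda>_. borel :: real measure)" and ?L = "PiM {i} (\<lambda>_. borel :: real measure)"
  define Y where "Y \<omega> = restrict (\<lambda>j. \<phi> j \<omega>) (I - {i})" for \<omega>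
  \<comment> \<open>The single phase is kept as a family over \<open>{i}\<close>, so that both
    blocks are restrictions of the same independent family; its value is read off at
    \<open>i\<close>.\<close>
  define X where "X \<omega> = restrict (\<lambda>j. \<phi> j \<omega>) {i}" for \<omega>
  have "indep_var ?N Y ?L X"
    unfolding X_def Y_def using \<open>i \<in> I\<close> by (intro indep_var_restrict[OF indep]) auto
  then have [measurable]: "Y \<in> measurable M ?N" "X \<in> measurable M ?L"
    and eq: "distr M ?N Y \<Otimes>\<^sub>M distr M ?L X = distr M (?N \<Otimes>\<^sub>M ?L) (\<lambda>\<omega>. (Y \<omega>, X \<omega>))"
    by (simp_all add: indep_var_distribution_eq)
  have \<phi>_i [measurable]: "\<phi> i \<in> borel_measurable M"
    using indep \<open>i \<in> I\<close> by (auto simp: indep_vars_def)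
  interpret \<phi>: real_distribution "distr M borel (\<phi> i)"
    by (intro real_distribution_distr) auto
  interpret X: prob_space "distr M ?L X"
    by (intro prob_space_distr) auto
  interpret Y: prob_space "distr M ?N Y"
    by (intro prob_space_distr) auto
  interpret pair_prob_space "distr M ?N Y" "distr M ?L X" ..
  have "AE x in distr M ?L X. \<not> Q y (x i)" for y
  proof (subst AE_distr_iff)
    have [measurable]: "{x. Q y x} \<in> sets borel"
      using count by (rule sets.countable[rotated]) auto
    have "{x \<in> space ?L. x i \<notin> {x. Q y x}} \<in> sets ?L"
      by measurable
    then show "{x \<in> space ?L. \<not> Q y (x i)} \<in> sets ?L" by simp
    show "AE \<omega> in M. \<not> Q y (X \<omega> i)"
      using AE_distrD[OF \<phi>_i AE_notin_countable_of_continuous_cdf[OF \<phi>.real_distribution_axioms cont count]]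
      by (simp add: X_def)
  qed auto
  moreover have "Measurable.pred (?N \<Otimes>\<^sub>M ?L) (\<lambda>z. \<not> Q (fst z) (snd z i))"
  proof -
    have "(\<lambda>z. (fst z, snd z i)) \<in> measurable (?N \<Otimes>\<^sub>M ?L) (?N \<Otimes>\<^sub>M borel)"
      by measurable
    from measurable_compose[OF this meas] have "Measurable.pred (?N \<Otimes>\<^sub>M ?L) (\<lambda>z. Q (fst z) (snd z i))"
      by simp
    then show ?thesis by measurable
  qed
  ultimately have "AE z in distr M ?N Y \<Otimes>\<^sub>M distr M ?L X. \<not> Q (fst z) (snd z i)"
    by (intro AE_pair_measure) (auto simp: pred_def space_pair_measure)
  then have "AE \<omega> in M. \<not> Q (fst (Y \<omega>, X \<omega>)) (snd (Y \<omega>, X \<omega>) i)"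
    unfolding eq by (rule AE_distrD[rotated]) measurable
  then show ?thesis by (simp add: X_def Y_def)
qed

text \<open>The phase at \<open>m\<close> separates the two full sums. These share the term at
  \<open>b\<close>, so their remainders over \<open>I - {b}\<close> differ as well. The remainders
  do not involve the phase at \<open>b\<close>, which can then separate the moduli.\<close>

lemma (in prob_space) AE_random_phase_separates:
  fixes \<phi> :: "'i \<Rightarrow> 'a \<Rightarrow> real" and u v :: "'i \<Rightarrow> complex"
  assumes indep: "indep_vars (\<lambda>_. borel) \<phi> I" and "finite I"
    and cont: "\<And>i. i \<in> I \<Longrightarrow> continuous_on UNIV (cdf (distr M borel (\<phi> i)))"
    and b: "b \<in> I" "u b = v b" "v b \<noteq> 0"
    and m: "m \<in> I" "u m \<noteq> v m"
  shows "AE \<omega> in M. cmod (\<Sum>i\<in>I. cis (\<phi> i \<omega>) * u i) \<noteq> cmod (\<Sum>i\<in>I. cis (\<phi> i \<omega>) * v i)"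
proof -
  define S where "S w J y = (\<Sum>i\<in>J. cis (y i) * w i)" for w :: "'i \<Rightarrow> complex" and J and y :: "'i \<Rightarrow> real"
  have S_restrict: "S w J (restrict y J) = S w J y" for w J y
    by (simp add: S_def)
  have S_remove: "S w I y = cis (y i) * w i + S w (I - {i}) y" if "i \<in> I" for w y i
    using that \<open>finite I\<close> by (simp add: S_def sum.remove)
  have S_measurable [measurable]: "S w J \<in> borel_measurable (PiM J (\<lambda>_. borel))" for w J
  proof -
    have "cis \<in> borel_measurable borel"
      by (intro borel_measurable_continuous_onI continuous_intros)
    then have [measurable]: "(\<lambda>y. cis (y i)) \<in> borel_measurable (PiM J (\<lambda>_. borel))" if "i \<in> J" for i
      using that by measurable
    show ?thesis unfolding S_def by measurable
  qed
  have [measurable]: "cis \<in> borel_measurable borel"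
    by (intro borel_measurable_continuous_onI continuous_intros)
  \<comment> \<open>With the other phases fixed, equality of the two sums prescribes the value of
    \<open>cis\<close> at the phase of \<open>m\<close>, because \<open>u m - v m\<close> is
    nonzero.\<close>
  have "AE \<omega> in M. \<not> (cis (\<phi> m \<omega>) * (u m - v m) + S (\<lambda>i. u i - v i) (I - {m}) (restrict (\<lambda>j. \<phi> j \<omega>) (I - {m})) = 0)"
  proof (rule AE_indep_vars_countable_fibres[OF indep m(1) cont[OF m(1)],
        where Q = "\<lambda>y x. cis x * (u m - v m) + S (\<lambda>i. u i - v i) (I - {m}) y = 0"])
    fix y
    show "countable {x. cis x * (u m - v m) + S (\<lambda>i. u i - v i) (I - {m}) y = 0}"
      using m(2) by (intro countable_subset[OF _ countable_cis_eq[of "- S (\<lambda>i. u i - v i) (I - {m}) y / (u m - v m)"]])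
        (auto simp: field_simps eq_neg_iff_add_eq_0)
  next
    show "Measurable.pred (PiM (I - {m}) (\<lambda>_. borel) \<Otimes>\<^sub>M borel)
        (\<lambda>z. cis (snd z) * (u m - v m) + S (\<lambda>i. u i - v i) (I - {m}) (fst z) = 0)"
      by measurable
  qed
  \<comment> \<open>The event includes that the remainders differ: for equal remainders every phase
    at \<open>b\<close> gives equal moduli, and the fibre would be uncountable.\<close>
  moreover have "AE \<omega> in M. \<not> (S u (I - {b}) (restrict (\<lambda>j. \<phi> j \<omega>) (I - {b})) \<noteq> S v (I - {b}) (restrict (\<lambda>j. \<phi> j \<omega>) (I - {b})) \<and>
     cmod (cis (\<phi> b \<omega>) * v b + S u (I - {b}) (restrict (\<lambda>j. \<phi> j \<omega>) (I - {b}))) =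
     cmod (cis (\<phi> b \<omega>) * v b + S v (I - {b}) (restrict (\<lambda>j. \<phi> j \<omega>) (I - {b}))))"
  proof (rule AE_indep_vars_countable_fibres[OF indep b(1) cont[OF b(1)],
        where Q = "\<lambda>y x. S u (I - {b}) y \<noteq> S v (I - {b}) y \<and>
          cmod (cis x * v b + S u (I - {b}) y) = cmod (cis x * v b + S v (I - {b}) y)"])
    fix y
    show "countable {x. S u (I - {b}) y \<noteq> S v (I - {b}) y \<and>
          cmod (cis x * v b + S u (I - {b}) y) = cmod (cis x * v b + S v (I - {b}) y)}"
      using countable_cis_norm_eq[OF _ b(3)] by (cases "S u (I - {b}) y = S v (I - {b}) y") auto
  next
    show "Measurable.pred (PiM (I - {b}) (\<lambda>_. borel) \<Otimes>\<^sub>M borel)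
        (\<lambda>z. S u (I - {b}) (fst z) \<noteq> S v (I - {b}) (fst z) \<and>
        cmod (cis (snd z) * v b + S u (I - {b}) (fst z)) = cmod (cis (snd z) * v b + S v (I - {b}) (fst z)))"
      by measurable
  qed
  ultimately show ?thesis
  proof eventually_elim
    case (elim \<omega>)
    define y where "y = (\<lambda>j. \<phi> j \<omega>)"
    have "S (\<lambda>i. u i - v i) I y = S u I y - S v I y"
      by (simp add: S_def algebra_simps sum_subtractf)
    with elim(1) have "S u I y \<noteq> S v I y"
      by (simp add: S_restrict S_remove[OF m(1), of "\<lambda>i. u i - v i"] y_def)
    then have "S u (I - {b}) y \<noteq> S v (I - {b}) y"
      by (simp add: S_remove[OF b(1)] b(2))
    with elim(2) have "cmod (S u I y) \<noteq> cmod (S v I y)"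
      by (simp add: S_restrict S_remove[OF b(1)] b(2) y_def)
    then show ?case by (simp add: S_def y_def)
  qed
qed

section \<open>Fourier intensities and Kronecker's substitution\<close>

text \<open>The transform has period 1 in each frequency, since grid points are integral.
  Frequencies outside the square matter because Kronecker's substitution follows a line that leaves
  it.\<close>

lemma fourier_modulus_eq_everywhere:
  assumes "\<forall>w\<in>{-1/2..1/2} \<times> {-1/2..1/2}. (cmod (fourier p u w))\<^sup>2 = (cmod (fourier p v w))\<^sup>2"
  shows "cmod (fourier p u w) = cmod (fourier p v w)"
proof -
  obtain w1 w2 where w: "w = (w1, w2)" by fastforce
  define r where "r = (w1 - of_int (round w1), w2 - of_int (round w2))"
  have periodic: "fourier p u r = fourier p u w" for u
  proof -
    have "exp (- \<i> * of_real (2 * pi * (of_int m1 * (w1 - of_int (round w1)) + of_int m2 * (w2 - of_int (round w2))))) =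
        exp (- \<i> * of_real (2 * pi * (of_int m1 * w1 + of_int m2 * w2)))" for m1 m2 :: int
      unfolding exp_eq
      \<comment> \<open>Subtracting the rounded frequencies changes the exponent by
        \<open>2 * pi * \<i>\<close> times this integer.\<close>
      by (intro exI[of _ "m1 * round w1 + m2 * round w2"]) (simp add: algebra_simps)
    then show ?thesis unfolding w r_def fourier_def by simp
  qed
  have "r \<in> {-1/2..1/2} \<times> {-1/2..1/2}"
    using of_int_round_abs_le[of w1] of_int_round_abs_le[of w2] by (simp add: r_def abs_if split: if_splits)
  with assms have "(cmod (fourier p u r))\<^sup>2 = (cmod (fourier p v r))\<^sup>2" by blast
  then show ?thesis by (simp add: periodic)
qed

text \<open>A grid point is read as a two-digit number in base \<open>2 * k + 1\<close>.\<close>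

definition kronecker_exponent :: "nat \<Rightarrow> int \<times> int \<Rightarrow> nat" where
  "kronecker_exponent k m = nat (fst m + int k) + (2 * k + 1) * nat (snd m + int k)"

text \<open>The two-variable generating polynomial of \<open>u\<close>, shifted by \<open>k\<close>
  in both coordinates, with \<open>x\<close> and \<open>x ^ (2 * k + 1)\<close> put for its
  variables.\<close>

definition kronecker_poly :: "nat \<Rightarrow> (int \<times> int \<Rightarrow> complex) \<Rightarrow> complex poly" where
  "kronecker_poly k u = (\<Sum>m\<in>grid2 (2 * k + 1). monom (u m) (kronecker_exponent k m))"

lemma centered_odd: "centered (2 * k + 1) = {- int k..int k}" "centered (Suc (2 * k)) = {- int k..int k}"
  by (auto simp: centered_def)

lemma finite_grid2: "finite (grid2 p)"
  by (simp add: grid2_def centered_def)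

lemma inj_on_kronecker_exponent: "inj_on (kronecker_exponent k) (grid2 (2 * k + 1))"
proof (rule inj_onI)
  fix m m' assume m: "m \<in> grid2 (2 * k + 1)" "m' \<in> grid2 (2 * k + 1)"
    and eq: "kronecker_exponent k m = kronecker_exponent k m'"
  have digits: "kronecker_exponent k m mod (2 * k + 1) = nat (fst m + int k)"
      "kronecker_exponent k m div (2 * k + 1) = nat (snd m + int k)"
    if "m \<in> grid2 (2 * k + 1)" for m
  proof -
    \<comment> \<open>The low digit is below the base, so remainder and quotient recover both
      digits.\<close>
    from that have "nat (fst m + int k) < 2 * k + 1"
      by (auto simp: grid2_def centered_odd)
    then show "kronecker_exponent k m mod (2 * k + 1) = nat (fst m + int k)"
      "kronecker_exponent k m div (2 * k + 1) = nat (snd m + int k)"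
      unfolding kronecker_exponent_def by (simp_all only: mod_mult_self2 mod_less div_mult_self2) auto
  qed
  from digits[OF m(1)] digits[OF m(2)] eq
  have "nat (fst m + int k) = nat (fst m' + int k)" "nat (snd m + int k) = nat (snd m' + int k)"
    by metis+
  with m show "m = m'"
    by (auto simp: grid2_def centered_odd prod_eq_iff)
qed

lemma coeff_kronecker_poly:
  assumes "m \<in> grid2 (2 * k + 1)"
  shows "coeff (kronecker_poly k u) (kronecker_exponent k m) = u m"
proof -
  have "coeff (kronecker_poly k u) (kronecker_exponent k m) =
      (\<Sum>m'\<in>grid2 (2 * k + 1). if m' = m then u m' else 0)"
    using inj_on_kronecker_exponent[of k] assms
    by (auto simp: kronecker_poly_def coeff_sum inj_on_def intro!: sum.cong)
  then show ?thesis
    using assms by (simp add: finite_grid2)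
qed

text \<open>Both digits are maximal at the corner, so it carries the largest exponent. A corner
  value of 1 will thus make the polynomial monic of known degree.\<close>

lemma degree_kronecker_poly:
  assumes "u (int k, int k) \<noteq> 0"
  shows "degree (kronecker_poly k u) = kronecker_exponent k (int k, int k)"
proof (rule antisym)
  show "degree (kronecker_poly k u) \<le> kronecker_exponent k (int k, int k)"
    unfolding kronecker_poly_def
  proof (intro degree_sum_le finite_grid2)
    fix m assume "m \<in> grid2 (2 * k + 1)"
    then have "kronecker_exponent k m \<le> kronecker_exponent k (int k, int k)"
      unfolding kronecker_exponent_def by (intro add_mono mult_mono) (auto simp: grid2_def centered_odd)
    then show "degree (monom (u m) (kronecker_exponent k m)) \<le> kronecker_exponent k (int k, int k)"
      by (rule order_trans[OF degree_monom_le])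
  qed
  show "kronecker_exponent k (int k, int k) \<le> degree (kronecker_poly k u)"
    using assms by (intro le_degree) (simp add: coeff_kronecker_poly grid2_def centered_odd)
qed

text \<open>On the unit circle each monomial becomes a Fourier character, up to the common factor
  \<open>z ^ (k + (2 * k + 1) * k)\<close>. This factor comes from the shift by \<open>k\<close> and
  has modulus 1.\<close>

lemma cmod_poly_kronecker:
  assumes "z = exp (- \<i> * of_real (2 * pi * \<theta>))"
  shows "cmod (poly (kronecker_poly k u) z) = cmod (fourier (2 * k + 1) u (\<theta>, real (2 * k + 1) * \<theta>))"
proof -
  have "z ^ kronecker_exponent k (m1, m2) = z ^ (k + (2 * k + 1) * k) *
      exp (- \<i> * of_real (2 * pi * (of_int m1 * \<theta> + of_int m2 * (real (2 * k + 1) * \<theta>))))"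
    if "(m1, m2) \<in> grid2 (2 * k + 1)" for m1 m2
  proof -
    have "real (nat (m1 + int k)) = of_int m1 + real k" "real (nat (m2 + int k)) = of_int m2 + real k"
      using that by (auto simp: grid2_def centered_odd)
    then have "real (kronecker_exponent k (m1, m2)) =
        real (k + (2 * k + 1) * k) + (of_int m1 + of_int m2 * real (2 * k + 1))"
      by (simp add: kronecker_exponent_def algebra_simps)
    then have "complex_of_real (real (kronecker_exponent k (m1, m2))) =
        of_real (real (k + (2 * k + 1) * k) + (of_int m1 + of_int m2 * real (2 * k + 1)))"
      by (rule arg_cong)
    then show ?thesis
      unfolding assms exp_of_nat_mult[symmetric] exp_add[symmetric]
      by (intro arg_cong[of _ _ exp]) (simp add: algebra_simps)
  qed
  then have "poly (kronecker_poly k u) z = z ^ (k + (2 * k + 1) * k) *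
      fourier (2 * k + 1) u (\<theta>, real (2 * k + 1) * \<theta>)"
    unfolding kronecker_poly_def fourier_def poly_sum case_prod_conv sum_distrib_left
    by (intro sum.cong) (auto simp: poly_monom)
  moreover have "cmod z = 1" by (simp add: assms)
  ultimately show ?thesis by (simp add: norm_mult norm_power)
qed

text \<open>The corner value 1 makes the Kronecker polynomial of \<open>u\<close> monic of the same
  degree as that of \<open>v\<close>, and its coefficients return \<open>u\<close> on the grid.
  Values off the grid do not enter the transform, hence the restriction.\<close>

lemma finite_same_intensity:
  assumes "v (int k, int k) = 1"
  shows "finite {restrict u (grid2 (2 * k + 1)) | u. u (int k, int k) = 1 \<and>
    (\<forall>w. cmod (fourier (2 * k + 1) u w) = cmod (fourier (2 * k + 1) v w))}"
proof (rule finite_subset)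
  have corner: "(int k, int k) \<in> grid2 (2 * k + 1)"
    by (simp add: grid2_def centered_odd)
  define Q where "Q = {q. degree q = degree (kronecker_poly k v) \<and> lead_coeff q = 1 \<and>
    (\<forall>z. cmod z = 1 \<longrightarrow> cmod (poly q z) = cmod (poly (kronecker_poly k v) z))}"
  show "finite ((\<lambda>q. \<lambda>m\<in>grid2 (2 * k + 1). coeff q (kronecker_exponent k m)) ` Q)"
    unfolding Q_def
  proof (intro finite_imageI finite_same_modulus_unit_circle)
    show "kronecker_poly k v \<noteq> 0"
      using coeff_kronecker_poly[OF corner, of v] assms by auto
  qed
  have in_Q: "kronecker_poly k u \<in> Q"
    if u: "u (int k, int k) = 1" "\<And>w. cmod (fourier (2 * k + 1) u w) = cmod (fourier (2 * k + 1) v w)" for u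
  proof -
    have "cmod (poly (kronecker_poly k u) z) = cmod (poly (kronecker_poly k v) z)" if z: "cmod z = 1" for z
    proof -
      obtain t where "z = exp (\<i> * of_real t)"
        using z complex_norm_eq_1_exp[of z] by metis
      \<comment> \<open>The angle \<theta> is \<open>- t / (2 * pi)\<close>, the sign matching the
        negative exponent of the transform.\<close>
      moreover have "2 * pi * (- t / (2 * pi)) = - t" by simp
      ultimately have "z = exp (- \<i> * of_real (2 * pi * (- t / (2 * pi))))"
        by (simp only: of_real_minus minus_mult_minus)
      then show ?thesis
        by (simp only: cmod_poly_kronecker u(2))
    qed
    then show ?thesis
      using u(1) assms by (simp add: Q_def degree_kronecker_poly coeff_kronecker_poly[OF corner])
  qed
  show "{restrict u (grid2 (2 * k + 1)) | u. u (int k, int k) = 1 \<and>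
      (\<forall>w. cmod (fourier (2 * k + 1) u w) = cmod (fourier (2 * k + 1) v w))}
    \<subseteq> (\<lambda>q. \<lambda>m\<in>grid2 (2 * k + 1). coeff q (kronecker_exponent k m)) ` Q"
  proof safe
    fix u assume "u (int k, int k) = 1" "\<forall>w. cmod (fourier (2 * k + 1) u w) = cmod (fourier (2 * k + 1) v w)"
    then have "kronecker_poly k u \<in> Q" using in_Q by blast
    then show "restrict u (grid2 (2 * k + 1))
        \<in> (\<lambda>q. \<lambda>m\<in>grid2 (2 * k + 1). coeff q (kronecker_exponent k m)) ` Q"
      by (rule rev_image_eqI) (intro restrict_ext, simp only: coeff_kronecker_poly)
  qed
qed

section \<open>Uniqueness from the plain and the masked intensities\<close>

theorem theorem3p1:
  fixes n p :: nat
    and f :: "int \<times> int \<times> int \<Rightarrow> complex"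
    and t :: "real \<times> real \<times> real"
    and l :: "int \<times> int"
    and M :: "'w measure"
    and \<mu> :: "int \<times> int \<Rightarrow> 'w \<Rightarrow> complex"
  assumes "odd n" and "n > 1"
    and "p = padded n"
    and "f \<in> objects n"
    and "t \<in> directions"
    and "supported n f t l"
    and "mask_assumption M p \<mu>"
  shows "AE \<omega> in M. \<forall>g\<in>objects n. supported n g t l \<longrightarrow>
    (\<forall>w\<in>{-1/2..1/2} \<times> {-1/2..1/2}.
       (cmod (fourier p (phase_object (translated n g t l)) w))\<^sup>2 =
       (cmod (fourier p (phase_object (translated n f t l)) w))\<^sup>2) \<longrightarrow>
    (\<forall>w\<in>{-1/2..1/2} \<times> {-1/2..1/2}.
       (cmod (fourier p (\<lambda>m. \<mu> m \<omega> * phase_object (translated n g t l) m) w))\<^sup>2 =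
       (cmod (fourier p (\<lambda>m. \<mu> m \<omega> * phase_object (translated n f t l) m) w))\<^sup>2) \<longrightarrow>
    (\<forall>c\<in>grid2 p. phase_object (projection n g t) c = phase_object (projection n f t) c)"
proof -
  obtain \<phi> :: "int \<times> int \<Rightarrow> 'w \<Rightarrow> real" where "prob_space M"
    and indep: "prob_space.indep_vars M (\<lambda>_. borel) \<phi> (grid2 p)"
    and cont: "\<And>m. m \<in> grid2 p \<Longrightarrow> continuous_on UNIV (cdf (distr M borel (\<phi> m)))"
    and \<mu>: "\<And>m \<omega>. m \<in> grid2 p \<Longrightarrow> \<omega> \<in> space M \<Longrightarrow> \<mu> m \<omega> = cis (\<phi> m \<omega>)"
    using assms(7) unfolding mask_assumption_def cis_conv_exp by blast
  interpret prob_space M by fact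
  \<comment> \<open>The padded grid then has coordinates from \<open>- k\<close> to
    \<open>k\<close>, and \<open>b\<close> is its corner of largest exponent.\<close>
  define k where "k = n - 1"
  define b where "b = (int k, int k)"
  have p: "p = 2 * k + 1"
    using assms(2,3) by (simp add: k_def padded_def)
  have b_grid: "b \<in> grid2 p"
    unfolding p b_def by (simp add: grid2_def centered_odd)
  \<comment> \<open>Here \<open>n > 1\<close> enters: only then does \<open>n - 1\<close> exceed
    \<open>(n - 1) / 2\<close>.\<close>
  have "b \<notin> grid2 n"
    using assms(2) by (auto simp: b_def k_def grid2_def centered_def)
  have outside: "phase_object (translated n h t l) m = 1" if "supported n h t l" "m \<notin> grid2 n" for h m
  proof -
    have "translated n h t l m = 0"
      using that by (auto simp: supported_def support_on_def)
    then show ?thesis by (simp add: phase_object_def)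
  qed
  define v where "v = phase_object (translated n f t l)"
  have v_b: "v b = 1"
    using outside \<open>b \<notin> grid2 n\<close> assms(6) by (simp add: v_def)
  \<comment> \<open>The candidates allowed by the plain intensities; the set is fixed before the
    mask is drawn.\<close>
  define U where "U = {restrict u (grid2 p) | u. u b = 1 \<and> (\<forall>w. cmod (fourier p u w) = cmod (fourier p v w))}"
  have "finite U"
    using finite_same_intensity v_b unfolding U_def p b_def by blast
  have "AE \<omega> in M. u \<noteq> restrict v (grid2 p) \<longrightarrow>
      cmod (\<Sum>m\<in>grid2 p. cis (\<phi> m \<omega>) * u m) \<noteq> cmod (\<Sum>m\<in>grid2 p. cis (\<phi> m \<omega>) * v m)" if "u \<in> U" for u
  proof (cases "u = restrict v (grid2 p)")
    case False
    from that have u: "u b = 1" "u \<in> extensional (grid2 p)"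
      using b_grid by (auto simp: U_def)
    with False obtain m where "m \<in> grid2 p" "u m \<noteq> v m"
      by (metis extensionalityI restrict_apply' restrict_extensional)
    then show ?thesis
      using AE_random_phase_separates[OF indep finite_grid2 cont b_grid, of u v m] u v_b by auto
  qed auto
  \<comment> \<open>As \<open>U\<close> is finite, one null set serves all candidates, and so all
    objects \<open>g\<close> at once.\<close>
  then have "AE \<omega> in M. \<forall>u\<in>U. u \<noteq> restrict v (grid2 p) \<longrightarrow>
      cmod (\<Sum>m\<in>grid2 p. cis (\<phi> m \<omega>) * u m) \<noteq> cmod (\<Sum>m\<in>grid2 p. cis (\<phi> m \<omega>) * v m)"
    using \<open>finite U\<close> by (simp add: AE_finite_all)
  then show ?thesis
    using AE_space
  proof eventually_elim
    case (elim \<omega>)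
    show ?case
    proof (intro ballI impI)
      fix g c
      assume supp: "supported n g t l" and "c \<in> grid2 p"
        and plain: "\<forall>w\<in>{-1/2..1/2} \<times> {-1/2..1/2}.
          (cmod (fourier p (phase_object (translated n g t l)) w))\<^sup>2 =
          (cmod (fourier p (phase_object (translated n f t l)) w))\<^sup>2"
        and masked: "\<forall>w\<in>{-1/2..1/2} \<times> {-1/2..1/2}.
          (cmod (fourier p (\<lambda>m. \<mu> m \<omega> * phase_object (translated n g t l) m) w))\<^sup>2 =
          (cmod (fourier p (\<lambda>m. \<mu> m \<omega> * phase_object (translated n f t l) m) w))\<^sup>2"
      define u where "u = phase_object (translated n g t l)"
      have "u b = 1"
        using outside \<open>b \<notin> grid2 n\<close> supp by (simp add: u_def)
      moreover have "\<forall>w. cmod (fourier p u w) = cmod (fourier p v w)"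
        using fourier_modulus_eq_everywhere[OF plain] by (simp add: u_def v_def)
      ultimately have "restrict u (grid2 p) \<in> U"
        unfolding U_def by blast
      moreover have "cmod (\<Sum>m\<in>grid2 p. cis (\<phi> m \<omega>) * restrict u (grid2 p) m) =
          cmod (\<Sum>m\<in>grid2 p. cis (\<phi> m \<omega>) * v m)"
      proof -
        \<comment> \<open>At frequency 0 the masked transform is the sum weighted by the random
          phases.\<close>
        have "fourier p (\<lambda>m. \<mu> m \<omega> * h m) (0, 0) = (\<Sum>m\<in>grid2 p. cis (\<phi> m \<omega>) * h m)" for h
          using elim(2) by (auto simp: fourier_def \<mu> intro!: sum.cong)
        then show ?thesis
          using fourier_modulus_eq_everywhere[OF masked, of "(0, 0)"] by (simp add: u_def v_def)
      qed
      ultimately have eq: "restrict u (grid2 p) = restrict v (grid2 p)"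
        using elim(1) by blast
      \<comment> \<open>Equality is needed at all integer points, since \<open>c - l\<close> may
        leave the padded grid; there both phase objects are 1 by the support assumption.\<close>
      have "u m = v m" for m
      proof (cases "m \<in> grid2 p")
        case True
        then show ?thesis using eq by (metis restrict_apply')
      next
        case False
        moreover have "grid2 n \<subseteq> grid2 p"
          using assms(2) by (auto simp: p k_def grid2_def centered_def)
        ultimately have "m \<notin> grid2 n" by blast
        then show ?thesis
          using outside supp assms(6) by (simp add: u_def v_def)
      qed
      then have "u (c - l) = v (c - l)" .
      then show "phase_object (projection n g t) c = phase_object (projection n f t) c"
        by (simp add: u_def v_def phase_object_def translated_def)
    qed
  qed
qed

end
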